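(* Let $t\in\mathbb{R}$. Then the sequence $B(t;x)=(B_n(t;x))_{n\ge0}$ of generalized Bernoulli polynomials of order $t$ has associated sequence $\boldsymbol{b(t)}=(b_n(t))_{n\ge0}$ given by $$b_n(t)=\sum_{k=0}^n\frac{\binom{t}{k}\binom{n-t}{n-k}}{\binom{k+n}{n}}\,s(k+n,k),\qquad n\in\mathbb{N}_0,$$ where $s(n,k)$ are the Stirling numbers of the first kind. In particular, for $t=m\in\mathbb{N}$, $$b_n(m)=\frac{s(m+n,m)}{\binom{m+n}{n}},\qquad n\in\mathbb{N}_0.$$
   Context: $\mathbb{N}=\{1,2,\dots\}$, $\mathbb{N}_0=\mathbb{N}\cup\{0\}$. $\mathcal{G}$ is the set of real sequences $\boldsymbol{u}=(u_n)_{n\ge0}$ with $u_0\ne0$ and $\sum_{n\ge0}|u_n|r^n/n!<\infty$ for some $r>0$. An Appell sequence is a sequence of real polynomials $A(x)=(A_n(x))_{n\ge0}$ with $(A_n(0))_{n\ge0}\in\mathcal{G}$ and $A_n(x)=\sum_{k=0}^n\binom{n}{k}A_k(0)x^{n-k}$ for all $n\ge0$. With $\Delta^kf(x)=\sum_{j=0}^k\binom{k}{j}(-1)^{k-j}f(x+j)$ and $I_n(x)=x^n$, the sequence associated to an Appell sequence $A(x)$ is the unique $\boldsymbol{a}\in\mathcal{G}$ such that $A_n(x)=\sum_{k=0}^n\frac{a_k}{k!}\Delta^kI_n(x)$ for all $n\in\mathbb{N}_0$ and $x\in\mathbb{R}$. The generalized Bernoulli polynomials $B_n(t;x)$ of order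 $t\in\mathbb{R}$ are defined by $\sum_{n\ge0}B_n(t;x)\frac{z^n}{n!}=\left(\frac{z}{e^z-1}\right)^te^{xz}$ for complex $z$ near $0$ (with the branch of the power equal to $1$ at $z=0$). $s(n,k)$ are the (signed) Stirling numbers of the first kind, $x(x-1)\cdots(x-n+1)=\sum_{k=0}^ns(n,k)x^k$. For real $y$, $\binom{y}{k}=y(y-1)\cdots(y-k+1)/k!$. *)

theory Defs
  imports "HOL-Complex_Analysis.Complex_Analysis" "HOL-Combinatorics.Stirling"
begin

definition seq_G :: "(nat \<Rightarrow> real) set" where
  "seq_G = {u. u 0 \<noteq> 0 \<and> (\<exists>r>0. summable (\<lambda>n. \<bar>u n\<bar> * r ^ n / fact n))}"

definition appell_sequence :: "(nat \<Rightarrow> real poly) \<Rightarrow> bool" where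
  "appell_sequence A \<longleftrightarrow>
     (\<lambda>n. poly (A n) 0) \<in> seq_G \<and>
     (\<forall>n x. poly (A n) x = (\<Sum>k\<le>n. real (n choose k) * poly (A k) 0 * x ^ (n - k)))"

definition fwd_diff :: "nat \<Rightarrow> (real \<Rightarrow> real) \<Rightarrow> real \<Rightarrow> real" where
  "fwd_diff k f x = (\<Sum>j\<le>k. real (k choose j) * (-1) ^ (k - j) * f (x + real j))"

text \<open>
  The second argument is the sequence associated to the first. There is at most one such sequence,
  see \<open>associated_sequence_unique\<close> below.
\<close>
definition associated_sequence :: "(nat \<Rightarrow> real poly) \<Rightarrow> (nat \<Rightarrow> real) \<Rightarrow> bool" where
  "associated_sequence A a \<longleftrightarrow>
     a \<in> seq_G \<and>
     (\<forall>n x. poly (A n) x = (\<Sum>k\<le>n. a k / fact k * fwd_diff k (\<lambda>y. y ^ n) x))"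

text \<open>
  The signed Stirling numbers of the first kind, as the coefficients of the falling factorial
  \<open>x (x - 1) \<dots> (x - n + 1)\<close>. The library function \<^const>\<open>stirling\<close> is the unsigned version;
  \<open>stirling1_altdef\<close> below relates the two.
\<close>
definition stirling1 :: "nat \<Rightarrow> nat \<Rightarrow> real" where
  "stirling1 n k = coeff (\<Prod>i<n. [:- real i, 1:]) k"

text \<open>The function \<open>z / (e\<^sup>z - 1)\<close>, with its removable singularity at \<open>0\<close> filled in.\<close>
definition bernoulli_base :: "complex \<Rightarrow> complex" where
  "bernoulli_base z = (if z = 0 then 1 else z / (exp z - 1))"

text \<open>
  The power is the principal one. Near \<open>0\<close> its base is close to \<open>1\<close>, so this is
  the analytic branch with value \<open>1\<close> at \<open>0\<close>.
\<close>
definition bernoulli_genfun :: "real \<Rightarrow> (nat \<Rightarrow> real poly) \<Rightarrow> bool" where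
  "bernoulli_genfun t B \<longleftrightarrow>
     (\<forall>x. \<forall>\<^sub>F z in nhds 0.
        (\<lambda>n. complex_of_real (poly (B n) x) * z ^ n / fact n) sums
          (bernoulli_base z powr complex_of_real t * exp (complex_of_real x * z)))"

text \<open>
  The generalized Bernoulli polynomials of order \<open>t\<close>. Existence and uniqueness of the sequence
  are \<open>bernoulli_genfun_exists\<close> and \<open>bernoulli_genfun_unique\<close> below.
\<close>
definition gen_bernoulli :: "real \<Rightarrow> nat \<Rightarrow> real poly" where
  "gen_bernoulli t = (THE B. bernoulli_genfun t B)"


lemma fwd_diff_0: "fwd_diff 0 f x = f x"
  by (simp add: fwd_diff_def)

lemma fwd_diff_Suc: "fwd_diff (Suc k) f x = fwd_diff k (\<lambda>y. f (y + 1) - f y) x"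
proof -
  define g where "g = (\<lambda>j. f (x + real j))"
  have "fwd_diff (Suc k) f x = (\<Sum>j\<le>Suc k. real (Suc k choose j) * (-1) ^ (Suc k - j) * g j)"
    by (simp add: fwd_diff_def g_def)
  also have "\<dots> = (-1) ^ Suc k * g 0 +
      (\<Sum>j\<le>k. real (Suc k choose Suc j) * (-1) ^ (k - j) * g (Suc j))"
    by (subst sum.atMost_Suc_shift) simp
  also have "\<dots> = (-1) ^ Suc k * g 0 + (\<Sum>j\<le>k. real (k choose Suc j) * (-1) ^ (k - j) * g (Suc j))
      + (\<Sum>j\<le>k. real (k choose j) * (-1) ^ (k - j) * g (Suc j))"
    by (simp add: algebra_simps sum.distrib)
  also have "(-1) ^ Suc k * g 0 + (\<Sum>j\<le>k. real (k choose Suc j) * (-1) ^ (k - j) * g (Suc j)) =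
      (\<Sum>j\<le>Suc k. real (k choose j) * (-1) ^ (Suc k - j) * g j)"
    by (subst sum.atMost_Suc_shift) simp
  also have "\<dots> = (\<Sum>j\<le>k. - (real (k choose j) * (-1) ^ (k - j) * g j))"
    by (simp add: Suc_diff_le)
  finally have "fwd_diff (Suc k) f x = (\<Sum>j\<le>k. real (k choose j) * (-1) ^ (k - j) * g (Suc j))
      - (\<Sum>j\<le>k. real (k choose j) * (-1) ^ (k - j) * g j)"
    by (simp add: sum_negf)
  thus ?thesis
    by (simp add: fwd_diff_def g_def algebra_simps sum_subtractf)
qed

lemma fwd_diff_cong: "(\<And>y. f y = g y) \<Longrightarrow> fwd_diff k f x = fwd_diff k g x"
  by (simp add: fwd_diff_def)

lemma fwd_diff_linear:
  "fwd_diff k (\<lambda>y. \<Sum>i\<in>I. c i * f i y) x = (\<Sum>i\<in>I. c i * fwd_diff k (f i) x)"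
proof -
  have "fwd_diff k (\<lambda>y. \<Sum>i\<in>I. c i * f i y) x =
      (\<Sum>j\<le>k. \<Sum>i\<in>I. c i * (real (k choose j) * (-1) ^ (k - j) * f i (x + real j)))"
    by (simp add: fwd_diff_def sum_distrib_left mult.left_commute)
  also have "\<dots> = (\<Sum>i\<in>I. \<Sum>j\<le>k. c i * (real (k choose j) * (-1) ^ (k - j) * f i (x + real j)))"
    by (rule sum.swap)
  finally show ?thesis
    by (simp add: fwd_diff_def sum_distrib_left)
qed

lemma power_Suc_arg_diff:
  "(y + 1) ^ n - y ^ n = (\<Sum>i<n. real (n choose i) * y ^ i)" for y :: real
proof -
  have "(y + 1) ^ n = (\<Sum>i\<le>n. real (n choose i) * y ^ i)"
    by (simp add: binomial_ring)
  thus ?thesis by (simp flip: lessThan_Suc_atMost)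
qed

lemma fwd_diff_power_Suc:
  "fwd_diff (Suc k) (\<lambda>y. y ^ n) x = (\<Sum>i<n. real (n choose i) * fwd_diff k (\<lambda>y. y ^ i) x)"
  unfolding fwd_diff_Suc power_Suc_arg_diff by (rule fwd_diff_linear)

lemma fwd_diff_power_less: "n < k \<Longrightarrow> fwd_diff k (\<lambda>y. y ^ n) x = 0"
proof (induction k arbitrary: n)
  case (Suc k)
  thus ?case unfolding fwd_diff_power_Suc by (intro sum.neutral) simp
qed simp

lemma fwd_diff_power_same: "fwd_diff n (\<lambda>y. y ^ n) x = fact n"
proof (induction n)
  case (Suc n)
  have "fwd_diff (Suc n) (\<lambda>y. y ^ Suc n) x =
      (\<Sum>i<Suc n. real (Suc n choose i) * fwd_diff n (\<lambda>y. y ^ i) x)"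
    by (rule fwd_diff_power_Suc)
  also have "\<dots> = real (Suc n choose n) * fact n"
    using Suc by (simp add: fwd_diff_power_less del: binomial_Suc_Suc)
  finally show ?case by (simp add: binomial_Suc_n)
qed (simp add: fwd_diff_0)

lemma associated_sequence_unique:
  assumes "associated_sequence A a" "associated_sequence A b"
  shows   "a = b"
proof
  fix n show "a n = b n"
  proof (induction n rule: less_induct)
    case (less n)
    have eq: "poly (A n) 0 = (\<Sum>k<n. c k / fact k * fwd_diff k (\<lambda>y. y ^ n) 0) + c n"
      if "associated_sequence A c" for c
      using that by (simp add: associated_sequence_def fwd_diff_power_same flip: lessThan_Suc_atMost)
    show ?case
      using eq[OF assms(1)] eq[OF assms(2)] less by simp
  qed
qed

lemma stirling1_falling_factorial:
  "(\<Prod>i<n. x - real i) = (\<Sum>k\<le>n. stirling1 n k * x ^ k)"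
proof -
  let ?p = "\<Prod>i<n. [:- real i, 1:]"
  have "degree ?p \<le> (\<Sum>i<n. degree [:- real i, 1:])"
    using degree_prod_sum_le[of "{..<n}" "\<lambda>i. [:- real i, 1:]"] by (simp add: o_def)
  hence deg: "degree ?p \<le> n" by simp
  have "(\<Prod>i<n. x - real i) = poly ?p x"
    by (simp add: poly_prod algebra_simps)
  also have "\<dots> = (\<Sum>k\<le>n. coeff ?p k * x ^ k)"
    unfolding poly_altdef using deg
    by (intro sum.mono_neutral_left) (auto simp: coeff_eq_0)
  finally show ?thesis by (simp add: stirling1_def)
qed

lemma stirling1_altdef: "stirling1 n k = (-1) ^ (n + k) * real (stirling n k)"
proof (induction n arbitrary: k)
  case 0
  show ?case by (cases k) (auto simp: stirling1_def)
next
  case (Suc n)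
  have "(\<Prod>i<Suc n. [:- real i, 1:]) =
      smult (- real n) (\<Prod>i<n. [:- real i, 1:]) + pCons 0 (\<Prod>i<n. [:- real i, 1:])"
    by (simp add: mult.commute)
  hence "stirling1 (Suc n) k = - real n * stirling1 n k + (case k of 0 \<Rightarrow> 0 | Suc j \<Rightarrow> stirling1 n j)"
    by (cases k) (simp_all add: stirling1_def)
  hence "stirling1 (Suc n) k = - real n * ((-1) ^ (n + k) * real (stirling n k)) +
      (case k of 0 \<Rightarrow> 0 | Suc j \<Rightarrow> (-1) ^ (n + j) * real (stirling n j))"
    by (simp only: Suc)
  thus ?case
    by (cases k; cases n) (simp_all add: algebra_simps)
qed

lemma bernoulli_base_has_fps_expansion: "bernoulli_base has_fps_expansion fps_X / (fps_exp 1 - 1)"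
proof -
  have sd: "subdegree (fps_exp 1 - 1 :: complex fps) = 1"
    by (rule subdegreeI) auto
  have nz: "fps_exp 1 - 1 \<noteq> (0 :: complex fps)"
    using sd by auto
  have sd': "subdegree (1 - fps_exp 1 :: complex fps) = 1"
    using sd by (metis subdegree_minus_commute)
  have "(\<lambda>z. if z = 0 then 1 else z / (exp z - 1)) has_fps_expansion fps_X / (fps_exp 1 - 1 :: complex fps)"
    by (rule has_fps_expansion_divide) (auto intro!: fps_expansion_intros simp: sd nz sd')
  thus ?thesis by (simp add: bernoulli_base_def[abs_def])
qed

lemma bernoulli_base_cnj: "bernoulli_base (cnj z) = cnj (bernoulli_base z)"
  by (simp add: bernoulli_base_def flip: exp_cnj)

lemma bernoulli_base_powr_has_fps_expansion:
  obtains C :: "nat \<Rightarrow> real" where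
    "(\<lambda>z. bernoulli_base z powr complex_of_real t) has_fps_expansion Abs_fps (\<lambda>n. complex_of_real (C n))"
proof -
  let ?f = "\<lambda>z. bernoulli_base z powr complex_of_real t"
  have an: "bernoulli_base analytic_on {0}"
    using bernoulli_base_has_fps_expansion by (rule has_fps_expansion_imp_analytic_0)
  have b0: "bernoulli_base 0 = 1" by (simp add: bernoulli_base_def)
  have "?f analytic_on {0}"
    by (intro analytic_intros an) (auto simp: b0)
  then obtain F where F: "?f has_fps_expansion F"
    using analytic_at_imp_has_fps_expansion_0 by blast
  have "isCont bernoulli_base 0"
    using an analytic_at_imp_isCont by blast
  hence "((\<lambda>z. Re (bernoulli_base z)) \<longlongrightarrow> 1) (nhds 0)"
    using tendsto_Re[of bernoulli_base 1 "nhds 0"] by (simp add: isCont_def b0 tendsto_nhds_iff)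
  hence evpos: "eventually (\<lambda>z. Re (bernoulli_base z) > 0) (nhds 0)"
    by (rule order_tendstoD) simp
  have rad: "eventually (\<lambda>z. z \<in> eball 0 (fps_conv_radius F)) (nhds 0)"
    using F by (intro eventually_nhds_in_open) (auto simp: has_fps_expansion_def zero_ereal_def)
  have ev: "eventually (\<lambda>z. (\<lambda>n. fps_nth F n * z ^ n) sums ?f z) (nhds 0)"
    using rad F[unfolded has_fps_expansion_def, THEN conjunct2]
  proof eventually_elim
    case (elim z)
    thus ?case using sums_eval_fps[of z F] by (simp add: in_eball_iff)
  qed
  have "filterlim cnj (nhds 0) (nhds 0)"
    by (rule tendsto_eq_intros filterlim_ident refl | simp)+
  from eventually_compose_filterlim[OF ev this]
  have "eventually (\<lambda>z. (\<lambda>n. cnj (fps_nth F n) * z ^ n) sums ?f z) (nhds 0)"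
    using evpos
  proof eventually_elim
    case (elim z)
    from elim(1) have "(\<lambda>n. cnj (fps_nth F n * cnj z ^ n)) sums cnj (?f (cnj z))"
      by (subst sums_cnj)
    moreover have "cnj (?f (cnj z)) = ?f z"
      using elim(2) by (subst cnj_powr) (auto simp: bernoulli_base_cnj)
    ultimately show ?case by simp
  qed
  hence "?f has_fps_expansion Abs_fps (\<lambda>n. cnj (fps_nth F n))"
    by (intro has_fps_expansionI) simp
  with F have "F = Abs_fps (\<lambda>n. cnj (fps_nth F n))"
    by (rule fps_expansion_unique_complex)
  hence "fps_nth F n = cnj (fps_nth F n)" for n
    by (metis fps_nth_Abs_fps)
  hence "complex_of_real (Re (fps_nth F n)) = fps_nth F n" for n
    by (metis Reals_cnj_iff of_real_Re)
  hence "Abs_fps (\<lambda>n. complex_of_real (Re (fps_nth F n))) = F"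
    by (intro fps_ext) simp
  with F show ?thesis
    by (intro that[of "\<lambda>n. Re (fps_nth F n)"]) simp
qed

lemma bernoulli_genfun_exists: "\<exists>B. bernoulli_genfun t B"
proof -
  obtain C :: "nat \<Rightarrow> real" where
    C: "(\<lambda>z. bernoulli_base z powr complex_of_real t) has_fps_expansion Abs_fps (\<lambda>n. complex_of_real (C n))"
    by (rule bernoulli_base_powr_has_fps_expansion)
  define B where "B = (\<lambda>n. \<Sum>i\<le>n. monom (fact n * C i / fact (n - i)) (n - i))"
  have "bernoulli_genfun t B"
    unfolding bernoulli_genfun_def
  proof
    fix x :: real
    let ?f = "\<lambda>z. bernoulli_base z powr complex_of_real t * exp (complex_of_real x * z)"
    define F where "F = Abs_fps (\<lambda>n. complex_of_real (C n)) * fps_exp (complex_of_real x)"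
    have F: "?f has_fps_expansion F"
      unfolding F_def by (intro fps_expansion_intros C)
    have nth: "fps_nth F n = complex_of_real (poly (B n) x) / fact n" for n
    proof -
      have "poly (B n) x / fact n = (\<Sum>i\<le>n. C i * (x ^ (n - i) / fact (n - i)))"
        by (simp add: B_def poly_sum poly_monom sum_divide_distrib)
      also have "complex_of_real \<dots> = fps_nth F n"
        by (simp add: F_def fps_mult_nth flip: atLeast0AtMost)
      finally show ?thesis by simp
    qed
    have "eventually (\<lambda>z. z \<in> eball 0 (fps_conv_radius F)) (nhds 0)"
      using F by (intro eventually_nhds_in_open) (auto simp: has_fps_expansion_def zero_ereal_def)
    thus "\<forall>\<^sub>F z in nhds 0. (\<lambda>n. complex_of_real (poly (B n) x) * z ^ n / fact n) sums ?f z"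
      using F[unfolded has_fps_expansion_def, THEN conjunct2]
    proof eventually_elim
      case (elim z)
      thus ?case using sums_eval_fps[of z F] by (simp add: in_eball_iff nth)
    qed
  qed
  thus ?thesis by blast
qed

lemma bernoulli_genfun_unique:
  assumes "bernoulli_genfun t A" "bernoulli_genfun t B"
  shows   "A = B"
proof
  fix n
  have "poly (A n) x = poly (B n) x" for x
  proof -
    let ?f = "\<lambda>z. bernoulli_base z powr complex_of_real t * exp (complex_of_real x * z)"
    have *: "?f has_fps_expansion Abs_fps (\<lambda>n. complex_of_real (poly (P n) x) / fact n)"
      if "bernoulli_genfun t P" for P
      using that by (intro has_fps_expansionI) (simp add: bernoulli_genfun_def)
    have "Abs_fps (\<lambda>n. complex_of_real (poly (A n) x) / fact n) =
          Abs_fps (\<lambda>n. complex_of_real (poly (B n) x) / fact n)"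
      by (rule fps_expansion_unique_complex[OF *[OF assms(1)] *[OF assms(2)]])
    from arg_cong[OF this, of "\<lambda>F. fps_nth F n"]
    have "complex_of_real (poly (A n) x) / fact n = complex_of_real (poly (B n) x) / fact n"
      by simp
    thus ?thesis by simp
  qed
  thus "A n = B n" using poly_eq_poly_eq_iff[of "A n" "B n"] by (simp add: fun_eq_iff)
qed

lemma bernoulli_genfun_gen_bernoulli: "bernoulli_genfun t (gen_bernoulli t)"
proof -
  obtain B where B: "bernoulli_genfun t B"
    using bernoulli_genfun_exists by blast
  show ?thesis
    unfolding gen_bernoulli_def
    by (rule theI[where P = "bernoulli_genfun t" and a = B]) (auto intro: B bernoulli_genfun_unique)
qed

end

theory Submission
  imports Defs
begin

text \<open>
  Write \<open>w = e\<^sup>z - 1\<close>. Since \<open>n! [z\<^sup>n] (e\<^sup>z - 1)\<^sup>k e\<^bsup>xz\<^esup> = \<Delta>\<^sup>k x\<^sup>n\<close>, the condition that \<open>a\<close>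
  be associated to an Appell sequence with generating function \<open>\<phi>(z) e\<^bsup>xz\<^esup>\<close> says
  \<open>\<phi>(z) = \<Sum>\<^sub>k a\<^sub>k w\<^sup>k / k!\<close>. For the Bernoulli polynomials of order \<open>t\<close>,
  \<open>\<phi>(z) = (z / (e\<^sup>z - 1))\<^sup>t\<close>, and \<open>z = ln (1 + w)\<close>. So the associated sequence consists of
  the Taylor coefficients, times factorials, of \<open>(ln (1 + w) / w)\<^sup>t\<close>
  (\<open>bernoulli_base_powr_expansion\<close>, \<open>associated_sequence_gen_bernoulli\<close>).

  It remains to compute these coefficients. For a natural exponent \<open>m\<close> they come from the
  generating function \<open>ln (1 + w)\<^sup>m / m! = \<Sum>\<^sub>n s(n, m) w\<^sup>n / n!\<close> of the Stirling numbers
  (\<open>log_ratio_power_nth\<close>). For general \<open>t\<close>, expanding \<open>(1 + v)\<^sup>t\<close> with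
  \<open>v = ln (1 + w) / w - 1\<close>, which has no constant term, shows that the \<open>n\<close>-th coefficient is a
  polynomial in \<open>t\<close> of degree at most \<open>n\<close>. It is therefore determined by its values at
  \<open>0, \<dots>, n\<close>, and the formula of the theorem is its Lagrange interpolation at these points
  (\<open>gbinomial_interpolation\<close>).

  The argument runs over the complex power series, because the principal power that defines the
  generating function is a complex function. All coefficients turn out to be images of reals, and
  the real identities are read off by injectivity of \<^const>\<open>of_real\<close>.
\<close>

section \<open>Composition with the exponential series and finite differences\<close>

text \<open>
  As \<open>F\<close> has no constant term, \<open>F\<^sup>k\<close> contributes to the first \<open>n + 1\<close> coefficients only for
  \<open>k \<le> n\<close>, so \<open>P oo F\<close> may be replaced by a polynomial in \<open>F\<close> before multiplying.
\<close>
lemma fps_compose_mult_nth: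
  fixes F P H :: "'a::idom fps"
  assumes "fps_nth F 0 = 0"
  shows "fps_nth ((P oo F) * H) n = (\<Sum>k\<le>n. fps_nth P k * fps_nth (F ^ k * H) n)"
proof -
  have "fps_nth (P oo F) i = (\<Sum>k\<le>n. fps_nth P k * fps_nth (F ^ k) i)" if "i \<le> n" for i
    unfolding fps_compose_nth using that startsby_zero_power_prefix[OF assms]
    by (intro sum.mono_neutral_left) auto
  hence "fps_nth ((P oo F) * H) n =
      (\<Sum>i\<le>n. \<Sum>k\<le>n. fps_nth P k * (fps_nth (F ^ k) i * fps_nth H (n - i)))"
    by (simp add: fps_mult_nth atLeast0AtMost sum_distrib_right mult.assoc)
  also have "\<dots> = (\<Sum>k\<le>n. \<Sum>i\<le>n. fps_nth P k * (fps_nth (F ^ k) i * fps_nth H (n - i)))"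
    by (rule sum.swap)
  finally show ?thesis
    by (simp add: fps_mult_nth atLeast0AtMost sum_distrib_left)
qed

text \<open>
  The binomial theorem turns the left-hand side into an alternating sum of the series of
  \<open>e\<^bsup>(x + j) z\<^esup>\<close>, whose coefficients are the values \<open>(x + j)\<^sup>n\<close> in the finite difference.
\<close>
lemma fps_exp_diff_power_mult_nth:
  "fps_nth ((fps_exp 1 - 1) ^ k * fps_exp (complex_of_real x)) n =
     complex_of_real (fwd_diff k (\<lambda>y. y ^ n) x) / fact n"
proof -
  have "(fps_exp 1 - 1) ^ k * fps_exp (complex_of_real x) =
      (\<Sum>j\<le>k. fps_const (of_nat (k choose j) * (-1) ^ (k - j)) * fps_exp (complex_of_real (x + real j)))"
    (is "?l = ?r")
  proof -
    have "(fps_exp 1 - 1 :: complex fps) ^ k = (fps_exp 1 + fps_const (- 1)) ^ k"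
      by (simp flip: fps_const_neg)
    also have "\<dots> = (\<Sum>j\<le>k. of_nat (k choose j) * fps_exp (of_nat j) * fps_const ((-1) ^ (k - j)))"
      by (simp only: binomial_ring fps_exp_power_mult fps_const_power mult_1_right)
    finally have "?l = (\<Sum>j\<le>k. of_nat (k choose j) * fps_exp (of_nat j) * fps_const ((-1) ^ (k - j))
        * fps_exp (complex_of_real x))"
      by (simp only: sum_distrib_right)
    thus ?thesis
      by (simp only: of_real_add of_real_of_nat_eq fps_exp_add_mult
            fps_of_nat[symmetric] fps_const_mult[symmetric] mult_ac)
  qed
  thus ?thesis
    by (simp add: fps_sum_nth fwd_diff_def sum_divide_distrib)
qed

section \<open>Powers of the logarithm series\<close>

text \<open>
  The exponential generating function of the Stirling numbers of the first kind. Writing \<open>L\<close> for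
  the series of \<open>ln (1 + w)\<close>, the equation \<open>(1 + w) (L\<^bsup>m+1\<^esup>)' = (m + 1) L\<^sup>m\<close> is, coefficient by
  coefficient, the triangular recurrence of these numbers.
\<close>
lemma fps_ln_power_nth:
  "fact n * fps_nth (fps_ln (1 :: 'a::field_char_0) ^ m) n =
     fact m * (-1) ^ (n + m) * of_nat (stirling n m)"
proof (induction n arbitrary: m)
  case 0
  show ?case by (cases m) (simp_all add: fps_nth_power_0)
next
  case (Suc n)
  show ?case
  proof (cases m)
    case 0
    thus ?thesis by simp
  next
    case (Suc j)
    let ?L = "fps_ln (1 :: 'a)"
    \<comment> \<open>Multiplying by \<open>1 + w\<close> removes the denominator of the derivative of the logarithm.\<close>
    have inv: "(1 + fps_X) * inverse (1 + fps_X :: 'a fps) = 1"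
      by (rule inverse_mult_eq_1') simp
    have "(1 + fps_X) * fps_deriv (?L ^ Suc j) =
        of_nat (Suc j) * ?L ^ j * ((1 + fps_X) * inverse (1 + fps_X))"
      by (simp only: fps_deriv_power' fps_ln_deriv diff_Suc_1) (simp add: mult_ac)
    hence "(1 + fps_X) * fps_deriv (?L ^ Suc j) = of_nat (Suc j) * ?L ^ j"
      by (simp only: inv mult_1_right)
    from arg_cong[OF this, of "\<lambda>F. fps_nth F n"]
    have "of_nat (Suc n) * fps_nth (?L ^ Suc j) (Suc n) + of_nat n * fps_nth (?L ^ Suc j) n =
        of_nat (Suc j) * fps_nth (?L ^ j) n"
      by (cases n) (simp_all add: algebra_simps fps_of_nat[symmetric] del: power_Suc of_nat_Suc)
    hence step: "of_nat (Suc n) * fps_nth (?L ^ Suc j) (Suc n) =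
        of_nat (Suc j) * fps_nth (?L ^ j) n - of_nat n * fps_nth (?L ^ Suc j) n"
      by (simp only: eq_diff_eq)
    have "fact n * (of_nat (Suc n) * fps_nth (?L ^ Suc j) (Suc n)) =
        of_nat (Suc j) * (fact n * fps_nth (?L ^ j) n) - of_nat n * (fact n * fps_nth (?L ^ Suc j) n)"
      unfolding step by (simp only: right_diff_distrib mult.left_commute)
    also have "\<dots> = fact (Suc j) * (-1) ^ (n + j) * of_nat (stirling (Suc n) (Suc j))"
      by (simp only: Suc.IH) (cases n; simp add: algebra_simps)
    finally show ?thesis
      using Suc by (simp add: algebra_simps)
  qed
qed

text \<open>The series of \<open>ln (1 + w) / w\<close>.\<close>
definition log_ratio :: "'a::field_char_0 fps" where
  "log_ratio = fps_shift 1 (fps_ln 1)"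

lemma log_ratio_nth_0 [simp]: "fps_nth log_ratio 0 = 1"
  by (simp add: log_ratio_def fps_ln_nth)

lemma log_ratio_times_X: "log_ratio * fps_X = fps_ln 1"
  by (rule fps_ext) (simp add: log_ratio_def)

lemma log_ratio_power_nth:
  "fact n * fps_nth (log_ratio ^ m :: complex fps) n =
     complex_of_real (stirling1 (m + n) m / real ((m + n) choose n))"
proof -
  have "fps_ln 1 ^ m = (log_ratio ^ m * fps_X ^ m :: complex fps)"
    by (simp add: power_mult_distrib flip: log_ratio_times_X)
  hence "fps_nth (log_ratio ^ m :: complex fps) n = fps_nth (fps_ln 1 ^ m) (m + n)"
    by (simp add: fps_X_power_mult_right_nth)
  also have "\<dots> = fact m * complex_of_real (stirling1 (m + n) m) / fact (m + n)"
    using fps_ln_power_nth[of "m + n" m, where ?'a = complex]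
    by (simp add: stirling1_altdef field_simps)
  finally show ?thesis
    by (simp add: binomial_fact)
qed

text \<open>
  The power \<open>(ln (1 + w) / w)\<^sup>c\<close> for an arbitrary exponent. The binomial series is composed
  with a series without constant term, so this makes sense over any field of characteristic 0.
\<close>
definition log_ratio_powr :: "'a::field_char_0 \<Rightarrow> 'a fps" where
  "log_ratio_powr c = fps_binomial c oo (log_ratio - 1)"

lemma log_ratio_powr_of_nat: "log_ratio_powr (of_nat m) = log_ratio ^ m"
  by (simp add: log_ratio_powr_def fps_binomial_of_nat fps_compose_add_distrib
        flip: fps_compose_power)

section \<open>Interpolation in the exponent\<close>

definition gbinomial_poly :: "nat \<Rightarrow> 'a::field_char_0 poly" where
  "gbinomial_poly k = smult (1 / fact k) (\<Prod>i<k. [:- of_nat i, 1:])"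

lemma poly_gbinomial_poly: "poly (gbinomial_poly k) x = x gchoose k"
  by (simp add: gbinomial_poly_def poly_prod gbinomial_prod_rev atLeast0LessThan)

lemma degree_gbinomial_poly: "degree (gbinomial_poly k :: 'a::field_char_0 poly) \<le> k"
proof -
  have "degree (\<Prod>i<k. [:- of_nat i, 1 :: 'a:]) \<le> (\<Sum>i<k. degree [:- of_nat i, 1 :: 'a:])"
    using degree_prod_sum_le[of "{..<k}" "\<lambda>i. [:- of_nat i, 1 :: 'a:]"] by (simp add: o_def)
  thus ?thesis by (simp add: gbinomial_poly_def)
qed

text \<open>
  At \<open>c = i \<le> n\<close> the product \<open>(c choose k) (n - c choose n - k)\<close> is 1 if \<open>k = i\<close>; otherwise one
  of its factors vanishes, the first if \<open>i < k\<close> and the second if \<open>i > k\<close>. Being of degree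
  \<open>n\<close> in \<open>c\<close>, these products are the Lagrange basis for the nodes \<open>0, \<dots>, n\<close>.
\<close>
lemma gbinomial_interpolation:
  fixes p :: "'a::field_char_0 poly"
  assumes "degree p \<le> n"
  shows "poly p c = (\<Sum>k\<le>n. (c gchoose k) * ((of_nat n - c) gchoose (n - k)) * poly p (of_nat k))"
proof -
  \<comment> \<open>The interpolation polynomial; it agrees with \<open>p\<close> at \<open>n + 1\<close> points.\<close>
  define q where "q = (\<Sum>k\<le>n. smult (poly p (of_nat k))
    (gbinomial_poly k * pcompose (gbinomial_poly (n - k)) [:of_nat n, -1:]))"
  have q: "poly q x = (\<Sum>k\<le>n. (x gchoose k) * ((of_nat n - x) gchoose (n - k)) * poly p (of_nat k))" for x
    by (simp add: q_def poly_sum poly_pcompose poly_gbinomial_poly mult_ac)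
  have deg: "degree q \<le> n"
    unfolding q_def
  proof (intro degree_sum_le)
    fix k assume k: "k \<in> {..n}"
    have "degree (pcompose (gbinomial_poly (n - k)) [:of_nat n, -1 :: 'a:]) \<le> n - k"
      using degree_gbinomial_poly[of "n - k", where ?'a = 'a] by (simp add: degree_pcompose)
    hence "degree (gbinomial_poly k * pcompose (gbinomial_poly (n - k)) [:of_nat n, -1 :: 'a:])
        \<le> k + (n - k)"
      using degree_gbinomial_poly[of k, where ?'a = 'a] degree_mult_le
      by (meson add_mono order_trans)
    thus "degree (smult (poly p (of_nat k))
        (gbinomial_poly k * pcompose (gbinomial_poly (n - k)) [:of_nat n, -1:])) \<le> n"
      using k by (intro order_trans[OF degree_smult_le]) auto
  qed simp
  have agree: "poly p x = poly q x" if x: "x \<in> of_nat ` {..n}" for x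
  proof -
    from x obtain i where i: "i \<le> n" "x = of_nat i" by auto
    have nz: "(x gchoose k) * ((of_nat n - x) gchoose (n - k)) = (if k = i then 1 else 0)"
      if "k \<le> n" for k
    proof -
      have "(x gchoose k) * ((of_nat n - x) gchoose (n - k)) =
          of_nat ((i choose k) * ((n - i) choose (n - k)))"
        using i by (simp add: binomial_gbinomial of_nat_diff)
      also have "(i choose k) * ((n - i) choose (n - k)) = (if k = i then 1 else 0)"
        using i that by (cases k i rule: linorder_cases) (auto simp: binomial_eq_0)
      finally show ?thesis by simp
    qed
    have "poly q x = (\<Sum>k\<le>n. (if k = i then 1 else 0) * poly p (of_nat k))"
      unfolding q by (intro sum.cong refl) (simp add: nz)
    also have "\<dots> = poly p x"
      using i by (simp add: if_distrib[of "\<lambda>u. u * _"] cong: if_cong)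
    finally show ?thesis ..
  qed
  have card: "card ((of_nat :: nat \<Rightarrow> 'a) ` {..n}) = Suc n"
    by (subst card_image) (auto simp: inj_on_def)
  have "p = q"
    by (rule poly_eqI_degree[OF agree]) (use assms deg card in auto)
  hence "poly p c = poly q c" by (rule arg_cong)
  also note q
  finally show ?thesis .
qed

text \<open>
  The exponent enters only through the coefficients \<open>c gchoose j\<close> of the binomial series, and
  only those with \<open>j \<le> n\<close> reach the \<open>n\<close>-th coefficient of the composition.
\<close>
lemma log_ratio_powr_nth_is_poly:
  obtains p :: "'a::field_char_0 poly"
  where "degree p \<le> n" "\<And>c. fps_nth (log_ratio_powr c) n = poly p c"
proof
  let ?p = "\<Sum>j\<le>n. smult (fps_nth ((log_ratio - 1) ^ j) n) (gbinomial_poly j :: 'a poly)"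
  show "degree ?p \<le> n"
  proof (intro degree_sum_le)
    fix j assume "j \<in> {..n}"
    thus "degree (smult (fps_nth ((log_ratio - 1) ^ j) n) (gbinomial_poly j :: 'a poly)) \<le> n"
      using degree_gbinomial_poly[of j, where ?'a = 'a]
      by (intro order_trans[OF degree_smult_le]) auto
  qed simp
  show "fps_nth (log_ratio_powr c) n = poly ?p c" for c
    by (simp add: log_ratio_powr_def fps_compose_nth poly_sum poly_gbinomial_poly
          atLeast0AtMost mult.commute)
qed

lemma of_real_gbinomial: "complex_of_real (t gchoose k) = complex_of_real t gchoose k"
  by (simp add: gbinomial_prod_rev)

definition bernoulli_assoc :: "real \<Rightarrow> nat \<Rightarrow> real" where
  "bernoulli_assoc t n = (\<Sum>k\<le>n. (t gchoose k) * ((real n - t) gchoose (n - k))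
     / real ((k + n) choose n) * stirling1 (k + n) k)"

text \<open>
  Interpolating at the exponents \<open>0, \<dots>, n\<close>, where the coefficients are Stirling numbers, yields
  those at the exponent \<open>t\<close>.
\<close>
lemma log_ratio_powr_nth:
  "fps_nth (log_ratio_powr (complex_of_real t)) n = complex_of_real (bernoulli_assoc t n) / fact n"
proof -
  obtain p :: "complex poly" where p: "degree p \<le> n" "\<And>c. fps_nth (log_ratio_powr c) n = poly p c"
    by (rule log_ratio_powr_nth_is_poly[of n]) blast
  have at_nat: "fact n * poly p (of_nat k) =
      complex_of_real (stirling1 (k + n) k / real ((k + n) choose n))" for k
    by (simp only: p(2)[symmetric] log_ratio_powr_of_nat log_ratio_power_nth)
  have "fact n * fps_nth (log_ratio_powr (complex_of_real t)) n =
      (\<Sum>k\<le>n. (of_real t gchoose k) * ((of_nat n - of_real t) gchoose (n - k)) *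
         (fact n * poly p (of_nat k)))"
    unfolding p(2) gbinomial_interpolation[OF p(1), of "complex_of_real t"]
    by (simp add: sum_distrib_left mult_ac)
  also have "\<dots> = complex_of_real (bernoulli_assoc t n)"
    unfolding at_nat by (simp add: bernoulli_assoc_def of_real_gbinomial)
  finally show ?thesis by (simp add: field_simps)
qed

text \<open>
  For a natural order, the interpolation formula collapses to a single Stirling number because both
  sides are coefficients of the same ordinary power.
\<close>
lemma bernoulli_assoc_of_nat:
  "bernoulli_assoc (real m) n = stirling1 (m + n) m / real ((m + n) choose n)"
proof -
  have "complex_of_real (bernoulli_assoc (real m) n) = fact n * fps_nth (log_ratio ^ m) n"
    using log_ratio_powr_nth[of "real m" n] by (simp add: log_ratio_powr_of_nat)
  thus ?thesis
    unfolding log_ratio_power_nth of_real_eq_iff .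
qed

section \<open>Analytic expansions\<close>

text \<open>
  This gives the growth condition on the associated sequence. The series is the expansion of an
  analytic function, the principal power near 1 composed with the sum of \<^const>\<open>log_ratio\<close>.
\<close>
lemma fps_conv_radius_log_ratio_powr: "fps_conv_radius (log_ratio_powr (c :: complex)) > 0"
proof -
  have "fps_conv_radius (log_ratio :: complex fps) > 0"
    by (simp add: log_ratio_def fps_conv_radius_ln)
  hence "eval_fps (log_ratio :: complex fps) has_fps_expansion log_ratio"
    by (rule eval_fps_has_fps_expansion)
  hence "((\<lambda>u. (1 + u) powr c) \<circ> (\<lambda>w. eval_fps log_ratio w - 1)) has_fps_expansion log_ratio_powr c"
    unfolding log_ratio_powr_def
    by (intro has_fps_expansion_compose fps_expansion_intros) auto
  thus ?thesis by (simp add: has_fps_expansion_def)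
qed

text \<open>
  The substitution \<open>w = e\<^sup>z - 1\<close>: it turns \<open>ln (1 + w) / w\<close> into \<open>z / (e\<^sup>z - 1)\<close>, because the
  logarithm series is the compositional inverse of \<open>e\<^sup>z - 1\<close>. Near 0 the principal power is given
  by the binomial series, so the same substitution works for the powers.
\<close>
lemma bernoulli_base_powr_expansion:
  "(\<lambda>z. bernoulli_base z powr c) has_fps_expansion (log_ratio_powr c oo (fps_exp 1 - 1))"
proof -
  let ?E = "fps_exp 1 - 1 :: complex fps"
  have "fps_nth ?E 1 \<noteq> fps_nth 0 1"
    by simp
  hence nz: "?E \<noteq> 0"
    by metis
  have "(log_ratio oo ?E) * ?E = (log_ratio * fps_X) oo ?E"
    by (simp add: fps_compose_mult_distrib)
  also have "\<dots> = fps_inv ?E oo ?E"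
    by (simp add: log_ratio_times_X fps_ln_fps_exp_inv)
  also have "\<dots> = fps_X"
    by (rule fps_inv) auto
  finally have "log_ratio oo ?E = fps_X / ?E"
    using nz by (metis nonzero_mult_div_cancel_right)
  hence base: "bernoulli_base has_fps_expansion (log_ratio oo ?E)"
    using bernoulli_base_has_fps_expansion by simp
  have "((\<lambda>u. (1 + u) powr c) \<circ> (\<lambda>z. bernoulli_base z - 1)) has_fps_expansion
      (fps_binomial c oo ((log_ratio oo ?E) - 1))"
    by (intro has_fps_expansion_compose fps_expansion_intros base) auto
  also have "fps_binomial c oo ((log_ratio oo ?E) - 1) = log_ratio_powr c oo ?E"
    by (simp add: log_ratio_powr_def fps_compose_sub_distrib flip: fps_compose_assoc)
  finally show ?thesis by (simp add: o_def)
qed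

section \<open>The generalized Bernoulli polynomials\<close>

lemma gen_bernoulli_egf:
  "Abs_fps (\<lambda>n. complex_of_real (poly (gen_bernoulli t n) x) / fact n) =
     (log_ratio_powr (of_real t) oo (fps_exp 1 - 1)) * fps_exp (of_real x)"
proof (rule fps_expansion_unique_complex)
  let ?f = "\<lambda>z. bernoulli_base z powr complex_of_real t * exp (complex_of_real x * z)"
  show "?f has_fps_expansion Abs_fps (\<lambda>n. complex_of_real (poly (gen_bernoulli t n) x) / fact n)"
    using bernoulli_genfun_gen_bernoulli[of t]
    by (intro has_fps_expansionI) (simp add: bernoulli_genfun_def)
  show "?f has_fps_expansion
      (log_ratio_powr (of_real t) oo (fps_exp 1 - 1)) * fps_exp (of_real x)"
    by (intro fps_expansion_intros bernoulli_base_powr_expansion)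
qed

lemma gen_bernoulli_nth:
  "complex_of_real (poly (gen_bernoulli t n) x) / fact n =
     fps_nth ((log_ratio_powr (of_real t) oo (fps_exp 1 - 1)) * fps_exp (of_real x)) n"
  by (simp flip: gen_bernoulli_egf)

lemma seq_G_I:
  assumes "u 0 \<noteq> 0" "fps_conv_radius F > 0"
    and "\<And>n. fps_nth F n = complex_of_real (u n) / fact n"
  shows "u \<in> seq_G"
proof -
  obtain r where r: "0 < ereal r" "ereal r < fps_conv_radius F"
    using ereal_dense2[OF assms(2)] by auto
  have "summable (\<lambda>n. norm (fps_nth F n * complex_of_real r ^ n))"
    using r by (intro abs_summable_in_conv_radius) (simp add: fps_conv_radius_def)
  hence "summable (\<lambda>n. \<bar>u n\<bar> * r ^ n / fact n)"
    using r by (simp add: assms(3) norm_mult norm_divide norm_power)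
  thus ?thesis using assms(1) r by (auto simp: seq_G_def)
qed

lemma bernoulli_assoc_0: "bernoulli_assoc t 0 = 1"
  by (simp add: bernoulli_assoc_def stirling1_def)

lemma appell_sequence_gen_bernoulli: "appell_sequence (gen_bernoulli t)"
  unfolding appell_sequence_def
proof (intro conjI allI)
  let ?S = "log_ratio_powr (complex_of_real t) oo (fps_exp 1 - 1)"
  have S: "fps_nth ?S n = complex_of_real (poly (gen_bernoulli t n) 0) / fact n" for n
    using gen_bernoulli_nth[of t n 0] by simp
  show "(\<lambda>n. poly (gen_bernoulli t n) 0) \<in> seq_G"
  proof (rule seq_G_I[where F = ?S])
    show "poly (gen_bernoulli t 0) 0 \<noteq> 0"
      using S[of 0] by (simp add: log_ratio_powr_nth bernoulli_assoc_0)
    show "fps_conv_radius ?S > 0"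
      using bernoulli_base_powr_expansion by (simp add: has_fps_expansion_def)
  qed (rule S)
  fix n x
  have "complex_of_real (poly (gen_bernoulli t n) x) =
      fact n * (\<Sum>k\<le>n. fps_nth ?S k * fps_nth (fps_exp (complex_of_real x)) (n - k))"
    using gen_bernoulli_nth[of t n x]
    unfolding fps_mult_nth atLeast0AtMost by (simp add: nonzero_divide_eq_eq mult.commute)
  also have "\<dots> = complex_of_real
      (\<Sum>k\<le>n. real (n choose k) * poly (gen_bernoulli t k) 0 * x ^ (n - k))"
    by (simp add: S sum_distrib_left binomial_fact field_simps)
  finally show "poly (gen_bernoulli t n) x =
      (\<Sum>k\<le>n. real (n choose k) * poly (gen_bernoulli t k) 0 * x ^ (n - k))"
    unfolding of_real_eq_iff .
qed

text \<open>
  Expanding \<open>\<Sum>\<^sub>k p\<^sub>k (e\<^sup>z - 1)\<^sup>k e\<^bsup>xz\<^esup>\<close>, with \<open>p\<^sub>k\<close> the coefficients of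
  \<^const>\<open>log_ratio_powr\<close>, term by term produces exactly the differences \<open>\<Delta>\<^sup>k x\<^sup>n\<close>.
\<close>
lemma associated_sequence_gen_bernoulli:
  "associated_sequence (gen_bernoulli t) (bernoulli_assoc t)"
  unfolding associated_sequence_def
proof (intro conjI allI)
  show "bernoulli_assoc t \<in> seq_G"
    by (rule seq_G_I[OF _ fps_conv_radius_log_ratio_powr log_ratio_powr_nth])
       (simp add: bernoulli_assoc_0)
  fix n x
  have "complex_of_real (poly (gen_bernoulli t n) x) / fact n =
      (\<Sum>k\<le>n. fps_nth (log_ratio_powr (of_real t)) k *
         fps_nth ((fps_exp 1 - 1) ^ k * fps_exp (of_real x)) n)"
    unfolding gen_bernoulli_nth by (rule fps_compose_mult_nth) simp
  also have "\<dots> = complex_of_real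
      (\<Sum>k\<le>n. bernoulli_assoc t k / fact k * fwd_diff k (\<lambda>y. y ^ n) x) / fact n"
    by (simp add: log_ratio_powr_nth fps_exp_diff_power_mult_nth sum_divide_distrib)
  finally have "complex_of_real (poly (gen_bernoulli t n) x) = complex_of_real
      (\<Sum>k\<le>n. bernoulli_assoc t k / fact k * fwd_diff k (\<lambda>y. y ^ n) x)"
    by simp
  thus "poly (gen_bernoulli t n) x =
      (\<Sum>k\<le>n. bernoulli_assoc t k / fact k * fwd_diff k (\<lambda>y. y ^ n) x)"
    unfolding of_real_eq_iff .
qed

lemma associated_sequence_gen_bernoulli_iff:
  "associated_sequence (gen_bernoulli t) a \<longleftrightarrow> a = bernoulli_assoc t"
  using associated_sequence_gen_bernoulli associated_sequence_unique by blast

theorem theorem5: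
  fixes t :: real
  shows "appell_sequence (gen_bernoulli t) \<and>
    (\<forall>a. associated_sequence (gen_bernoulli t) a \<longleftrightarrow>
       a = (\<lambda>n. \<Sum>k\<le>n. (t gchoose k) * ((real n - t) gchoose (n - k)) / real ((k + n) choose n)
                       * stirling1 (k + n) k)) \<and>
    (\<forall>m::nat. m \<ge> 1 \<longrightarrow> (\<forall>a. associated_sequence (gen_bernoulli (real m)) a \<longleftrightarrow>
       a = (\<lambda>n. stirling1 (m + n) m / real ((m + n) choose n))))"
  unfolding associated_sequence_gen_bernoulli_iff bernoulli_assoc_of_nat[symmetric]
  by (simp add: appell_sequence_gen_bernoulli fun_eq_iff bernoulli_assoc_def)

end
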